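(* Let $$T(t)=\frac{1+t-\sqrt{1-2t-3t^2}}{2t},\qquad a(v)=\frac{(t-v)t^3T^8(t)}{(1+t)^3(1+t-vT^2(t))},\qquad b(v)=\frac{tT^3(t)(2-T(t))}{(1-v)(1+v-vT(t))(1+t-vT^2(t))}.$$ Then $$\sum_{n\geq1}c_n(11\text{-}2)t^n=\frac{(1+t)(1-t-\sqrt{1-2t-3t^2})}{2t}+\frac{t^2T(t)}{1+t}\sum_{j\geq1}b\left(\frac{t^{j}T^{2j-1}(t)}{(1+t)^{j}}\right)\prod_{i=1}^{j-1}a\left(\frac{t^{i}T^{2i-1}(t)}{(1+t)^{i}}\right).$$
   Context: A Catalan word of length $n\ge 1$ is a sequence $\pi=\pi_1\cdots\pi_n$ of positive integers with $\pi_1=1$ and $\pi_{i+1}\le \pi_i+1$ for $1\le i\le n-1$; $\mathcal{C}_n$ is the set of these. A word $\pi$ contains the vincular pattern $11\text{-}2$ if there are indices $i,j$ with $i+1<j\le n$ such that $\pi_i=\pi_{i+1}<\pi_j$; otherwise $\pi$ avoids it. $c_n(\tau)$ denotes the number of members of $\mathcal{C}_n$ avoiding $\tau$. $T^k(t)$ means $(T(t))^k$. The identity is one of power series in $t$ (all expressions expanded about $t=0$, the square root having constant term $1$); an empty product equals $1$. *)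

theory Defs
  imports Complex_Main "HOL-Computational_Algebra.Formal_Power_Series"
begin

text \<open>Words are lists; list positions are counted from 0.\<close>
definition catalan_words :: "nat \<Rightarrow> nat list set" where
  "catalan_words n = {w. length w = n \<and> n \<ge> 1 \<and> (\<forall>x\<in>set w. x \<ge> 1) \<and> w ! 0 = 1 \<and>
     (\<forall>i. i + 1 < n \<longrightarrow> w ! (i + 1) \<le> w ! i + 1)}"

definition contains_11_2 :: "nat list \<Rightarrow> bool" where
  "contains_11_2 w \<longleftrightarrow>
     (\<exists>i j. i + 1 < j \<and> j < length w \<and> w ! i = w ! (i + 1) \<and> w ! (i + 1) < w ! j)"

text \<open>A pattern is represented by the predicate that says which words contain it.\<close>
definition avoid_count :: "(nat list \<Rightarrow> bool) \<Rightarrow> nat \<Rightarrow> nat" where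
  "avoid_count contains n = card {w \<in> catalan_words n. \<not> contains w}"

text \<open>The series are formal power series in t = \<^const>\<open>fps_X\<close>, and infinite sums refer to
  the t-adic topology on \<^typ>\<open>real fps\<close>. Division of formal power series also covers
  denominators divisible by t; the quotients by \<^term>\<open>2 * fps_X\<close> below are exact since their
  numerators have constant term 0.\<close>

definition sqrt_disc :: "real fps" where
  "sqrt_disc = fps_radical root 2 (1 - 2 * fps_X - 3 * fps_X ^ 2)"

lemma sqrt_disc_nth_0: "fps_nth sqrt_disc 0 = 1"
  by (simp add: sqrt_disc_def numeral_2_eq_2)

lemma sqrt_disc_square: "sqrt_disc ^ 2 = 1 - 2 * fps_X - 3 * fps_X ^ 2"
  using power_radical[of "1 - 2 * fps_X - 3 * fps_X ^ 2 :: real fps" root 1]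
  by (simp add: sqrt_disc_def numeral_2_eq_2)

definition T_fps :: "real fps" where
  "T_fps = (1 + fps_X - sqrt_disc) / (2 * fps_X)"

text \<open>The arguments v of the next two functions have constant term 0 in all uses, so the
  denominators are units.\<close>

definition a_fun :: "real fps \<Rightarrow> real fps" where
  "a_fun v = ((fps_X - v) * fps_X ^ 3 * T_fps ^ 8) /
     ((1 + fps_X) ^ 3 * (1 + fps_X - v * T_fps ^ 2))"

definition b_fun :: "real fps \<Rightarrow> real fps" where
  "b_fun v = (fps_X * T_fps ^ 3 * (2 - T_fps)) /
     ((1 - v) * (1 + v - v * T_fps) * (1 + fps_X - v * T_fps ^ 2))"

definition arg_fps :: "nat \<Rightarrow> real fps" where
  "arg_fps j = (fps_X ^ j * T_fps ^ (2 * j - 1)) / (1 + fps_X) ^ j"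

end

theory Submission
  imports Defs
begin

text \<open>
  Read a word from left to right. A word avoids 11-2 exactly when every plateau \<open>l l\<close> acts as a cap:
  no later letter exceeds \<open>l\<close>. A later plateau lies at or below the cap and replaces it. So the
  possible continuations depend only on the last letter \<open>l\<close> and the current cap \<open>c\<close>; let \<open>g l c\<close> be
  their generating function \<open>cont_fps l c\<close> and \<open>f l = g l l\<close> its value just after a plateau at height \<open>l\<close>.

  Splitting off the first letter and subtracting the equations for consecutive last letters gives,
  for fixed \<open>c\<close>, a three-term recurrence in \<open>l\<close> for \<open>g l c\<close> whose inhomogeneity is
  \<open>t (f (l + 1) - f l)\<close>. It is summed against weights that solve the adjoint recurrence
  (\<open>weighted_cont_fps\<close>); the adjoint characteristic roots are \<open>1 / T\<close> and \<open>q / T\<close>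
  with \<open>q = T - 1\<close>. Two choices of weights matter.

  The combination of both roots that eliminates \<open>g 1 c\<close> leaves a relation between the \<open>f a\<close> alone.
  It collapses to the first-order recurrence
  \<open>(1 - q^(a+4)) f (a + 1) = (1 + q + q^2) (1 - q^(a+2)) f a\<close> with \<open>f 0 = 1\<close>
  (\<open>cont_fps_diag_step\<close>). Consequently \<open>\<Psi>(v) = \<Sum>a\<ge>0. (f (a + 1) - 1) v^a\<close> satisfies
  the q-difference equation \<open>\<Psi>(v) = b(v) + a(v) \<Psi>(q v)\<close> (\<open>plateau_sum_step\<close>). Subtracting 1
  from \<open>f\<close> is what produces the factors \<open>1 - v\<close> and \<open>1 + v - v T = 1 - q v\<close> in the denominator
  of \<open>b\<close>.

  The pure powers of the root \<open>q / T\<close> instead express \<open>g 1 c\<close>, for a cap too large to be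
  felt, through \<open>\<Psi>(q / T)\<close> (\<open>cont_fps_1_plateau_sum\<close>). As \<open>arg_fps j = q^j / T\<close>, iterating the
  q-difference equation from \<open>v = q / T\<close> yields the series of the theorem. The term before the
  series is \<open>(1 + t) q\<close>: words without plateau are counted by \<open>q\<close>, words that end with their
  first plateau by \<open>t q\<close>.

  What keeps the algebra manageable is that everything is rational in \<open>q\<close>:
  \<open>t = q / (1 + q + q^2)\<close>, \<open>1 + t = (1 + q)^2 / (1 + q + q^2)\<close> and \<open>T = 1 + q\<close>. Limits are
  handled with truncated sums, as congruences modulo powers of \<open>t\<close>.
\<close>

section \<open>Congruence of power series modulo powers of t\<close>

lemma fps_X_power_dvd_iff:
  fixes f :: "'a :: comm_ring_1 fps"
  shows "fps_X ^ n dvd f \<longleftrightarrow> (\<forall>i<n. fps_nth f i = 0)"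
proof
  assume "fps_X ^ n dvd f"
  then show "\<forall>i<n. fps_nth f i = 0"
    by (auto elim!: dvdE simp: fps_X_power_mult_nth)
next
  assume "\<forall>i<n. fps_nth f i = 0"
  then have "f = fps_X ^ n * fps_shift n f"
    by (auto simp: fps_eq_iff fps_X_power_mult_nth)
  then show "fps_X ^ n dvd f"
    by (metis dvd_triv_left)
qed

lemma fps_eq_if_X_powers_dvd_diff:
  fixes f g :: "'a :: comm_ring_1 fps"
  assumes "\<And>n. fps_X ^ n dvd f - g"
  shows "f = g"
proof (rule fps_ext)
  fix n
  show "fps_nth f n = fps_nth g n"
    using assms[of "Suc n"] unfolding fps_X_power_dvd_iff by simp
qed

lemma summable_fps_if_X_powers_dvd:
  fixes u :: "nat \<Rightarrow> 'a :: comm_ring_1 fps"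
  assumes u: "\<And>k. fps_X ^ k dvd u k"
  shows "summable u" and "fps_X ^ n dvd suminf u - (\<Sum>k<n. u k)"
proof -
  define L where "L = Abs_fps (\<lambda>n. fps_nth (\<Sum>k<Suc n. u k) n)"
  have stable: "fps_nth (\<Sum>k<m. u k) i = fps_nth L i" if "i < m" for i m
  proof -
    have "(\<Sum>k<m. u k) = (\<Sum>k<Suc i. u k) + (\<Sum>k\<in>{Suc i..<m}. u k)"
      using that by (metis Suc_leI atLeast0LessThan sum.atLeastLessThan_concat zero_le)
    moreover have "fps_nth (u k) i = 0" if "k \<in> {Suc i..<m}" for k
      using u[of k] that by (simp add: fps_X_power_dvd_iff)
    ultimately show ?thesis
      by (simp add: L_def fps_sum_nth)
  qed
  have "u sums L"
    unfolding sums_def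
  proof (rule tendsto_fpsI)
    fix i
    show "\<forall>\<^sub>F m in sequentially. fps_nth (\<Sum>k<m. u k) i = fps_nth L i"
      using eventually_gt_at_top[of i] by eventually_elim (rule stable)
  qed
  then show "summable u" and "fps_X ^ n dvd suminf u - (\<Sum>k<n. u k)"
    by (auto simp: sums_iff fps_X_power_dvd_iff stable)
qed

lemma fps_X_power_dvd_unit_mult_iff:
  fixes u :: "real fps"
  assumes "fps_nth u 0 \<noteq> 0"
  shows "fps_X ^ n dvd u * f \<longleftrightarrow> fps_X ^ n dvd f"
  using assms by (intro dvd_mult_unit_iff') simp

section \<open>Words as capped continuations\<close>

text \<open>The word \<open>xs\<close> can follow a last letter \<open>l\<close> under the cap \<open>c\<close>. Demanding \<open>l \<le> c\<close> at every step,
  rather than \<open>x \<le> c\<close> for the next letter, makes the count vanish for \<open>l > c\<close>, so that the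
  recurrences below need no special case at the cap.\<close>
fun capped_cont :: "nat \<Rightarrow> nat \<Rightarrow> nat list \<Rightarrow> bool" where
  "capped_cont l c [] \<longleftrightarrow> l \<le> c"
| "capped_cont l c (x # xs) \<longleftrightarrow>
     l \<le> c \<and> 1 \<le> x \<and> x \<le> l + 1 \<and> capped_cont x (if x = l then l else c) xs"

text \<open>The first of the two equal letters of an occurrence is either the first letter of the word or a
  later one; this is the recursion that matches the change of the cap.\<close>
lemma contains_11_2_Cons_Cons:
  "contains_11_2 (l # x # xs) \<longleftrightarrow> l = x \<and> (\<exists>y\<in>set xs. x < y) \<or> contains_11_2 (x # xs)"
  (is "?L \<longleftrightarrow> ?R")
proof
  assume ?L
  then obtain i j where ij: "i + 1 < j" "j < length (l # x # xs)"
      "(l # x # xs) ! i = (l # x # xs) ! (i + 1)" "(l # x # xs) ! (i + 1) < (l # x # xs) ! j"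
    unfolding contains_11_2_def by blast
  obtain k where k: "j = Suc (Suc k)"
    using ij(1) by (cases j; cases "j - 1") auto
  show ?R
  proof (cases i)
    case 0
    then show ?thesis
      using ij k by (auto intro!: bexI[of _ "xs ! k"])
  next
    case (Suc m)
    then show ?thesis
      using ij k unfolding contains_11_2_def
      by (intro disjI2 exI[of _ m] exI[of _ "Suc k"]) auto
  qed
next
  assume ?R
  then show ?L
  proof
    assume A: "l = x \<and> (\<exists>y\<in>set xs. x < y)"
    then obtain k where "k < length xs" "x < xs ! k"
      by (auto simp: in_set_conv_nth)
    then show ?L
      using A unfolding contains_11_2_def
      by (intro exI[of _ 0] exI[of _ "Suc (Suc k)"]) auto
  next
    assume "contains_11_2 (x # xs)"
    then obtain i j where "i + 1 < j" "j < length (x # xs)"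
        "(x # xs) ! i = (x # xs) ! (i + 1)" "(x # xs) ! (i + 1) < (x # xs) ! j"
      unfolding contains_11_2_def by blast
    then show ?L
      unfolding contains_11_2_def by (intro exI[of _ "Suc i"] exI[of _ "Suc j"]) auto
  qed
qed

lemma not_contains_11_2_singleton: "\<not> contains_11_2 [l]"
  by (simp add: contains_11_2_def)

lemma capped_cont_iff:
  "capped_cont l c xs \<longleftrightarrow>
     (\<forall>x\<in>set xs. 1 \<le> x) \<and> successively (\<lambda>x y. y \<le> x + 1) (l # xs) \<and>
     (\<forall>x\<in>set (l # xs). x \<le> c) \<and> \<not> contains_11_2 (l # xs)"
proof (induction l c xs rule: capped_cont.induct)
  case (1 l c)
  show ?case
    by (simp add: not_contains_11_2_singleton)
next
  case (2 l c x xs)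
  show ?case
    unfolding capped_cont.simps 2 contains_11_2_Cons_Cons
    by (auto simp: not_less)
qed

text \<open>Letters grow by at most 1 per step, so a cap of at least the word length imposes nothing.
  This lets a finite cap stand for the absence of one.\<close>
lemma successively_step_bound:
  assumes "successively (\<lambda>x y. y \<le> x + 1) (l # xs)" and "y \<in> set (l # xs)"
  shows "y \<le> l + length xs"
  using assms
proof (induction xs arbitrary: l)
  case (Cons x xs)
  then show ?case
    by (cases "y = l") (fastforce dest: Cons.IH)+
qed simp

lemma avoid_count_eq_card_capped_cont:
  assumes "Suc n \<le> c"
  shows "avoid_count contains_11_2 (Suc n) = card {xs. length xs = n \<and> capped_cont 1 c xs}"
proof -
  have "{w \<in> catalan_words (Suc n). \<not> contains_11_2 w} =
      (#) 1 ` {xs. length xs = n \<and> capped_cont 1 c xs}" (is "?A = _ ` ?B")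
  proof (intro set_eqI iffI)
    fix w
    assume "w \<in> ?A"
    then have w: "length w = Suc n" "\<forall>x\<in>set w. x \<ge> 1" "w ! 0 = 1"
        "\<forall>i. i + 1 < Suc n \<longrightarrow> w ! (i + 1) \<le> w ! i + 1" "\<not> contains_11_2 w"
      by (auto simp: catalan_words_def)
    then obtain xs where xs: "w = 1 # xs" "length xs = n"
      by (cases w) auto
    have succ: "successively (\<lambda>x y. y \<le> x + 1) (1 # xs)"
      using w xs by (simp add: successively_conv_nth)
    have "capped_cont 1 c xs"
      unfolding capped_cont_iff
      using w xs succ successively_step_bound[OF succ] assms by fastforce
    then show "w \<in> (#) 1 ` ?B"
      using xs by blast
  next
    fix w
    assume "w \<in> (#) 1 ` ?B"
    then show "w \<in> ?A"
      by (auto simp: catalan_words_def capped_cont_iff successively_conv_nth)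
  qed
  then show ?thesis
    unfolding avoid_count_def by (simp add: card_image)
qed

lemma finite_capped_cont: "finite {xs. length xs = n \<and> capped_cont l c xs}"
proof (rule finite_subset)
  show "{xs. length xs = n \<and> capped_cont l c xs} \<subseteq> {xs. set xs \<subseteq> {..c} \<and> length xs = n}"
    by (auto simp: capped_cont_iff)
qed (simp add: finite_lists_length_eq)

definition cont_fps :: "nat \<Rightarrow> nat \<Rightarrow> real fps" where
  "cont_fps l c = Abs_fps (\<lambda>n. real (card {xs. length xs = n \<and> capped_cont l c xs}))"

lemma cont_fps_eq_0: "c < l \<Longrightarrow> cont_fps l c = 0"
  by (auto simp: cont_fps_def fps_eq_iff capped_cont_iff)

lemma cont_fps_first_letter:
  assumes "l \<le> c"
  shows "cont_fps l c = 1 + fps_X * (\<Sum>x\<in>{1..l+1}. cont_fps x (if x = l then l else c))"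
proof (rule fps_ext)
  fix n
  show "fps_nth (cont_fps l c) n =
      fps_nth (1 + fps_X * (\<Sum>x\<in>{1..l+1}. cont_fps x (if x = l then l else c))) n"
  proof (cases n)
    case 0
    have "{xs. length xs = 0 \<and> capped_cont l c xs} = {[]}"
      using assms by auto
    then show ?thesis
      by (simp add: cont_fps_def 0 cong: conj_cong)
  next
    case (Suc m)
    let ?B = "\<lambda>x. {xs. length xs = m \<and> capped_cont x (if x = l then l else c) xs}"
    have "{xs. length xs = n \<and> capped_cont l c xs} = (\<Union>x\<in>{1..l+1}. (#) x ` ?B x)"
      using assms by (auto simp: Suc length_Suc_conv)
    also have "card \<dots> = (\<Sum>x\<in>{1..l+1}. card ((#) x ` ?B x))"
      by (rule card_UN_disjoint) (auto simp: finite_capped_cont)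
    also have "\<dots> = (\<Sum>x\<in>{1..l+1}. card (?B x))"
      by (simp add: card_image)
    finally show ?thesis
      by (simp add: cont_fps_def Suc fps_sum_nth)
  qed
qed

text \<open>The sums over the next letter for last letters \<open>l\<close> and \<open>l + 1\<close> share all terms below \<open>l\<close>, so
  their difference is local in \<open>l\<close>.\<close>
lemma cont_fps_step:
  assumes "1 \<le> l" "l < c"
  shows "(1 + fps_X) * cont_fps (Suc l) c =
    (1 + fps_X) * cont_fps l c + fps_X * cont_fps (Suc (Suc l)) c +
    fps_X * (cont_fps (Suc l) (Suc l) - cont_fps l l)"
proof -
  have below: "(\<Sum>x\<in>{1..<l}. cont_fps x (if x = m then m else c)) = (\<Sum>x\<in>{1..<l}. cont_fps x c)"
    if "l \<le> m" for m
    using that by (intro sum.cong) auto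
  have "{1..l+1} = insert l (insert (Suc l) {1..<l})"
    using assms by auto
  then have l: "cont_fps l c =
      1 + fps_X * (cont_fps l l + cont_fps (Suc l) c + (\<Sum>x\<in>{1..<l}. cont_fps x c))"
    using cont_fps_first_letter[of l c] below[of l] assms by simp
  have "{1..Suc l+1} = insert l (insert (Suc l) (insert (Suc (Suc l)) {1..<l}))"
    using assms by auto
  then have "cont_fps (Suc l) c = 1 + fps_X * (cont_fps l c + cont_fps (Suc l) (Suc l) +
      cont_fps (Suc (Suc l)) c + (\<Sum>x\<in>{1..<l}. cont_fps x c))"
    using cont_fps_first_letter[of "Suc l" c] below[of "Suc l"] assms by simp
  with l show ?thesis
    by (simp add: algebra_simps)
qed

lemma cont_fps_bottom:
  assumes "1 \<le> c"
  shows "cont_fps 1 c = 1 + fps_X * (cont_fps 1 1 + cont_fps 2 c)"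
proof -
  have "{1..1+1} = {1, 2::nat}"
    by auto
  then show ?thesis
    using cont_fps_first_letter[OF assms] by simp
qed

text \<open>The weights solve the adjoint of the recurrence in \<open>cont_fps_step\<close>, so the sum of all rows
  \<open>1 .. c\<close>, the row for \<open>l + 1\<close> taken with weight \<open>w l\<close>, telescopes: of the unknowns \<open>g l c\<close>
  only the two boundary ones with \<open>l = 1\<close> and \<open>l = c\<close> survive. The weights do not depend on the
  cap, which makes the identities for different caps comparable.\<close>
lemma weighted_cont_fps:
  fixes w :: "nat \<Rightarrow> real fps"
  assumes w: "\<And>m. (1 + fps_X) * w (Suc (Suc m)) = (1 + fps_X) * w (Suc m) - fps_X * w m"
    and "1 \<le> c"
  shows "(w 0 - (1 + fps_X) * w 1) * cont_fps 1 c + (1 + fps_X) * w c * cont_fps c c =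
    w 0 * (1 + fps_X * cont_fps 1 1) +
    fps_X * (\<Sum>l\<in>{1..<c}. w l * (cont_fps (Suc l) (Suc l) - cont_fps l l))"
proof -
  let ?f = "\<lambda>l. cont_fps l l"
  \<comment> \<open>The partial sum of the first \<open>k\<close> rows has one further boundary term, which vanishes for
    \<open>k = c\<close> because its last letter exceeds the cap.\<close>
  have "(w 0 - (1 + fps_X) * w 1) * cont_fps 1 c + (1 + fps_X) * w k * cont_fps k c
      - fps_X * w (k - 1) * cont_fps (Suc k) c =
    w 0 * (1 + fps_X * ?f 1) + fps_X * (\<Sum>l\<in>{1..<k}. w l * (?f (Suc l) - ?f l))"
    if "1 \<le> k" "k \<le> c" for k
    using that
  proof (induction k rule: nat_induct_at_least)
    case base
    then show ?case
      using cont_fps_bottom[of c] by (simp add: numeral_2_eq_2 algebra_simps)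
  next
    case (Suc k)
    obtain m where m: "k = Suc m"
      using Suc.hyps by (cases k) auto
    have step: "w k * ((1 + fps_X) * cont_fps (Suc k) c) = w k * ((1 + fps_X) * cont_fps k c +
        fps_X * cont_fps (Suc (Suc k)) c + fps_X * (?f (Suc k) - ?f k))"
      using cont_fps_step[of k c] Suc by simp
    have wk: "(1 + fps_X) * w (Suc k) * cont_fps (Suc k) c =
        ((1 + fps_X) * w k - fps_X * w m) * cont_fps (Suc k) c"
      using w[of m] m by simp
    have sum: "(\<Sum>l\<in>{1..<Suc k}. w l * (?f (Suc l) - ?f l)) =
        (\<Sum>l\<in>{1..<k}. w l * (?f (Suc l) - ?f l)) + w k * (?f (Suc k) - ?f k)"
      using Suc.hyps by simp
    have IH: "(w 0 - (1 + fps_X) * w 1) * cont_fps 1 c + (1 + fps_X) * w k * cont_fps k c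
        - fps_X * w m * cont_fps (Suc k) c =
      w 0 * (1 + fps_X * ?f 1) + fps_X * (\<Sum>l\<in>{1..<k}. w l * (?f (Suc l) - ?f l))"
      using Suc m by simp
    show ?case
      unfolding sum diff_Suc_1 using IH step wk by algebra
  qed
  from this[of c] show ?thesis
    using assms(2) by (simp add: cont_fps_eq_0)
qed

section \<open>A rational parametrisation of the coefficients\<close>

lemma sqrt_disc_nth_1: "fps_nth sqrt_disc 1 = -1"
proof -
  have "fps_nth (sqrt_disc ^ 2) 1 = -2"
    unfolding sqrt_disc_square by (simp add: fps_X_power_nth)
  then show ?thesis
    by (simp add: power2_eq_square fps_mult_nth_1 sqrt_disc_nth_0)
qed

lemma T_fps_mult: "2 * fps_X * T_fps = 1 + fps_X - sqrt_disc"
proof -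
  have "fps_X ^ 1 dvd 1 + fps_X - sqrt_disc"
    unfolding fps_X_power_dvd_iff by (simp add: sqrt_disc_nth_0)
  then have "2 * fps_X dvd 1 + fps_X - sqrt_disc"
    by (subst mult_unit_dvd_iff') (simp_all add: fps_numeral_nth_0)
  then show ?thesis
    unfolding T_fps_def by (rule dvd_mult_div_cancel)
qed

lemma T_fps_nth_0: "fps_nth T_fps 0 = 1"
proof -
  have "fps_nth (2 * fps_X * T_fps) 1 = 2"
    unfolding T_fps_mult using sqrt_disc_nth_1 by simp
  then show ?thesis
    by (simp add: mult.assoc numeral_fps_const)
qed

text \<open>\<open>T\<close> is defined as a root of a quadratic with discriminant \<open>1 - 2 t - 3 t^2\<close>. In this form it
  reads \<open>t T^2 = (1 + t) q\<close>, which identifies the ratio \<open>t T^2 / (1 + t)\<close> of consecutive arguments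
  in the theorem as \<open>q\<close>.\<close>
lemma T_fps_quadratic: "fps_X * T_fps ^ 2 = (1 + fps_X) * (T_fps - 1)"
proof -
  have "(1 + fps_X - 2 * fps_X * T_fps) ^ 2 = 1 - 2 * fps_X - 3 * fps_X ^ 2"
    using T_fps_mult sqrt_disc_square by simp
  then have "4 * fps_X * (fps_X * T_fps ^ 2 - (1 + fps_X) * (T_fps - 1)) = 0"
    by algebra
  then show ?thesis
    by simp
qed

text \<open>This is \<open>t\<close> times the Motzkin series; \<open>Q_fps\<close> below is the Motzkin series itself, as
  \<open>X_mult_Q_fps\<close> shows.\<close>
definition q_fps :: "real fps" where
  "q_fps = T_fps - 1"

abbreviation Q_fps :: "real fps" where
  "Q_fps \<equiv> 1 + q_fps + q_fps ^ 2"

lemma q_fps_nth_0: "fps_nth q_fps 0 = 0"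
  by (simp add: q_fps_def T_fps_nth_0)

lemma X_mult_Q_fps: "fps_X * Q_fps = q_fps"
  using T_fps_quadratic unfolding q_fps_def by algebra

lemma one_plus_X_mult_Q_fps: "(1 + fps_X) * Q_fps = (1 + q_fps) ^ 2"
  unfolding distrib_right[of 1 fps_X] X_mult_Q_fps
  by (simp add: power2_eq_square algebra_simps)

lemma Q_fps_inverse: "Q_fps * inverse Q_fps = 1"
  by (rule inverse_mult_eq_1') (simp add: q_fps_nth_0 power2_eq_square)

lemma T_fps_inverse: "(1 + q_fps) * inverse T_fps = 1"
  using inverse_mult_eq_1'[of T_fps] by (simp add: q_fps_def T_fps_nth_0)

lemma X_eq: "fps_X = q_fps * inverse Q_fps"
proof -
  have "fps_X = fps_X * (Q_fps * inverse Q_fps)"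
    unfolding Q_fps_inverse by simp
  then show ?thesis
    unfolding mult.assoc[symmetric] X_mult_Q_fps .
qed

lemma one_plus_X_eq: "1 + fps_X = (1 + q_fps) ^ 2 * inverse Q_fps"
proof -
  have "1 + fps_X = (1 + fps_X) * (Q_fps * inverse Q_fps)"
    unfolding Q_fps_inverse by simp
  then show ?thesis
    unfolding mult.assoc[symmetric] one_plus_X_mult_Q_fps .
qed

section \<open>The plateau series\<close>

text \<open>With last letter and cap both 0 no letter can follow. This value is not met in actual words,
  but it is the right initial value for extending the next recurrence down to \<open>a = 0\<close>.\<close>
lemma cont_fps_0_0: "cont_fps 0 0 = 1"
  using cont_fps_first_letter[of 0 0] by (simp add: cont_fps_eq_0)

text \<open>The weights \<open>T^(-m-1) (1 - q^(m+2))\<close> combine the two adjoint roots so that the coefficient of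
  \<open>g 1 c\<close> vanishes. Then \<open>weighted_cont_fps\<close> involves only the \<open>f a\<close>, and subtracting it for
  consecutive caps removes the sum.\<close>
lemma cont_fps_diag_step:
  "(1 - q_fps ^ (a + 4)) * cont_fps (Suc a) (Suc a) =
    Q_fps * (1 - q_fps ^ (a + 2)) * cont_fps a a"
proof -
  define U where "U = inverse T_fps"
  define r where "r = inverse Q_fps"
  define w where "w = (\<lambda>m. U ^ (m + 1) * (1 - q_fps ^ (m + 2)))"
  note TU = T_fps_inverse[folded U_def] and Qr = Q_fps_inverse[folded r_def]
    and X = X_eq[folded r_def] and X1 = one_plus_X_eq[folded r_def]
  have XU: "(1 + fps_X) * U = (1 + q_fps) * r"
    using X1 TU by algebra
  have w_rec: "(1 + fps_X) * w (Suc (Suc m)) = (1 + fps_X) * w (Suc m) - fps_X * w m" for m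
  proof -
    \<comment> \<open>Powers with symbolic exponents are abstracted so that polynomial identities remain.\<close>
    define z p where "z = U ^ m" and "p = q_fps ^ m"
    have "(1 + fps_X) * U ^ 3 = U * r" 
      using XU TU by algebra
    moreover have "(1 + fps_X) * U ^ 2 = r" 
      using XU TU by algebra
    moreover have "fps_X * U = r - U * r" 
      using X TU by algebra
    ultimately have "(1 + fps_X) * (z * U ^ 3 * (1 - p * q_fps ^ 4)) =
        (1 + fps_X) * (z * U ^ 2 * (1 - p * q_fps ^ 3)) - fps_X * (z * U * (1 - p * q_fps ^ 2))"
      using TU by algebra
    then show ?thesis
      by (simp add: w_def z_def p_def power_add power2_eq_square power3_eq_cube power4_eq_xxxx mult_ac)
  qed
  have w_bottom: "w 0 = (1 + fps_X) * w 1"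
  proof -
    have "U * (1 - q_fps ^ 2) = (1 + fps_X) * (U ^ 2 * (1 - q_fps ^ 3))"
      using XU TU Qr by algebra
    then show ?thesis
      by (simp add: w_def numeral_2_eq_2 numeral_3_eq_3)
  qed
  have eq: "(1 + fps_X) * w c * cont_fps c c = w 0 * (1 + fps_X * cont_fps 1 1) +
      fps_X * (\<Sum>l\<in>{1..<c}. w l * (cont_fps (Suc l) (Suc l) - cont_fps l l))" if "1 \<le> c" for c
    using weighted_cont_fps[of w c, OF w_rec that] w_bottom by simp
  have key: "((1 + fps_X) * w (Suc a) - fps_X * w a) * cont_fps (Suc a) (Suc a) = w a * cont_fps a a"
  proof (cases "a = 0")
    case True
    then show ?thesis
      using eq[of 1] by (simp add: cont_fps_0_0 algebra_simps)
  next
    case False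
    have sum: "(\<Sum>l\<in>{1..<Suc a}. w l * (cont_fps (Suc l) (Suc l) - cont_fps l l)) =
        (\<Sum>l\<in>{1..<a}. w l * (cont_fps (Suc l) (Suc l) - cont_fps l l)) +
        w a * (cont_fps (Suc a) (Suc a) - cont_fps a a)"
      using False by simp
    have "(1 + fps_X) * w (Suc a) * cont_fps (Suc a) (Suc a) =
        (1 + fps_X) * w a * cont_fps a a +
        fps_X * (w a * (cont_fps (Suc a) (Suc a) - cont_fps a a))"
      using eq[of a] eq[of "Suc a", unfolded sum distrib_left[of fps_X]] False by simp
    then show ?thesis
      by (simp add: algebra_simps)
  qed
  define p where "p = q_fps ^ a"
  have "(1 + fps_X) * w (Suc a) - fps_X * w a = U ^ (a + 1) * (r * (1 - q_fps ^ (a + 4)))"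
  proof -
    have "(1 + fps_X) * U * (1 - p * q_fps ^ 3) - fps_X * (1 - p * q_fps ^ 2) = r * (1 - p * q_fps ^ 4)"
      unfolding XU unfolding X by algebra
    then have "U ^ (a + 1) * ((1 + fps_X) * U * (1 - p * q_fps ^ 3) - fps_X * (1 - p * q_fps ^ 2)) =
       U ^ (a + 1) * (r * (1 - p * q_fps ^ 4))"
      by simp
    then show ?thesis
      by (simp add: w_def p_def power_add power2_eq_square power3_eq_cube power4_eq_xxxx algebra_simps)
  qed
  then have "U ^ (a + 1) * (r * (1 - q_fps ^ (a + 4)) * cont_fps (Suc a) (Suc a)) =
      U ^ (a + 1) * ((1 - q_fps ^ (a + 2)) * cont_fps a a)"
    using key by (simp add: w_def mult_ac)
  moreover have "U \<noteq> 0"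
    using TU by auto
  ultimately have "r * (1 - q_fps ^ (a + 4)) * cont_fps (Suc a) (Suc a) =
      (1 - q_fps ^ (a + 2)) * cont_fps a a"
    by simp
  then have "Q_fps * (r * (1 - q_fps ^ (a + 4)) * cont_fps (Suc a) (Suc a)) =
      Q_fps * ((1 - q_fps ^ (a + 2)) * cont_fps a a)"
    by (rule arg_cong)
  then show ?thesis
    unfolding mult.assoc[symmetric] Qr mult_1_left .
qed

text \<open>The truncation of \<open>\<Psi>(v)\<close>. The subtracted 1 accounts for the empty continuation after the
  plateau; words ending with their first plateau are counted separately.\<close>
definition plateau_sum :: "nat \<Rightarrow> real fps \<Rightarrow> real fps" where
  "plateau_sum N v = (\<Sum>a<N. (cont_fps (Suc a) (Suc a) - 1) * v ^ a)"

text \<open>This is the recurrence \<open>cont_fps_diag_step\<close> multiplied by \<open>v^a\<close> and summed: a factor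
  \<open>q^a\<close> turns \<open>v\<close> into \<open>q v\<close>, an index shift gives a factor \<open>v\<close>. The truncation leaves a single
  boundary term with \<open>v^N\<close>.\<close>
lemma plateau_sum_functional:
  "(1 - v * Q_fps) * plateau_sum N v =
    q_fps ^ 3 * Q_fps * (fps_X - v) * plateau_sum N (q_fps * v) +
    q_fps * (1 + q_fps) * (\<Sum>a<N. (1 - q_fps ^ (a + 1)) * v ^ a) -
    Q_fps * (1 - q_fps ^ (N + 2)) * (cont_fps N N - 1) * v ^ N"
proof (induction N)
  case 0
  then show ?case
    by (simp add: plateau_sum_def cont_fps_0_0)
next
  case (Suc N)
  define p where "p = q_fps ^ N"
  define e e' where "e = cont_fps N N - 1" and "e' = cont_fps (Suc N) (Suc N) - 1"
  have step: "(1 - p * q_fps ^ 4) * (e' + 1) = Q_fps * (1 - p * q_fps ^ 2) * (e + 1)"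
    using cont_fps_diag_step[of N]
    unfolding p_def e_def e'_def power_add by (simp only: diff_add_cancel)
  have pN: "q_fps ^ (N + 1) = p * q_fps" "q_fps ^ (N + 2) = p * q_fps ^ 2"
      "q_fps ^ (Suc N + 2) = p * q_fps ^ 3"
    by (simp_all add: p_def power2_eq_square power3_eq_cube)
  have S: "plateau_sum (Suc N) v = plateau_sum N v + e' * v ^ N"
      "plateau_sum (Suc N) (q_fps * v) = plateau_sum N (q_fps * v) + e' * (p * v ^ N)"
      "v ^ Suc N = v * v ^ N"
    by (simp_all add: plateau_sum_def p_def e'_def power_mult_distrib)
  define m where "m = Q_fps * (fps_X - v)"
  have m: "m = q_fps - v * Q_fps"
    unfolding m_def using X_mult_Q_fps by (simp add: algebra_simps)
  \<comment> \<open>The summand added to the identity, without its factor \<open>v^N\<close>. The boundary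
    term with \<open>e'\<close> takes the place of the one with \<open>e\<close>.\<close>
  have coeff: "(1 - v * Q_fps) * e' - q_fps ^ 3 * m * (p * e') =
      q_fps * (1 + q_fps) * (1 - p * q_fps) - Q_fps * (1 - p * q_fps ^ 3) * e' * v +
      Q_fps * (1 - p * q_fps ^ 2) * e"
    unfolding m using step by algebra
  have "(1 - v * Q_fps) * (e' * v ^ N) = q_fps ^ 3 * m * (e' * (p * v ^ N)) +
      ((1 - v * Q_fps) * e' - q_fps ^ 3 * m * (p * e')) * v ^ N"
    by algebra
  then have "(1 - v * Q_fps) * (e' * v ^ N) = q_fps ^ 3 * m * (e' * (p * v ^ N)) +
      q_fps * (1 + q_fps) * ((1 - p * q_fps) * v ^ N) -
      Q_fps * (1 - p * q_fps ^ 3) * e' * (v * v ^ N) + Q_fps * (1 - p * q_fps ^ 2) * e * v ^ N"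
    unfolding coeff by (simp add: algebra_simps)
  then have new: "(1 - v * Q_fps) * (e' * v ^ N) =
      q_fps ^ 3 * Q_fps * (fps_X - v) * (e' * (p * v ^ N)) +
      q_fps * (1 + q_fps) * ((1 - p * q_fps) * v ^ N) -
      Q_fps * (1 - p * q_fps ^ 3) * e' * (v * v ^ N) + Q_fps * (1 - p * q_fps ^ 2) * e * v ^ N"
    by (simp only: m_def mult.assoc)
  show ?case
    unfolding S pN sum.lessThan_Suc distrib_left[of "1 - v * Q_fps"]
      distrib_left[of "q_fps ^ 3 * Q_fps * (fps_X - v)"] distrib_left[of "q_fps * (1 + q_fps)"]
    unfolding Suc.IH[unfolded pN, folded e_def] new e'_def[symmetric] by simp
qed

lemma geometric_difference:
  fixes q v :: "'a :: comm_ring_1"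
  shows "(1 - v) * (1 - q * v) * (\<Sum>a<N. (1 - q ^ (a + 1)) * v ^ a) =
    (1 - q) - v ^ N * ((1 - q * v) - q ^ (N + 1) * (1 - v))"
proof (induction N)
  case (Suc N)
  show ?case
    unfolding sum.lessThan_Suc distrib_left Suc.IH by (simp add: algebra_simps)
qed (simp add: algebra_simps)

section \<open>The coefficients of the expansion\<close>

lemma fps_divide_mult_unit:
  fixes f g :: "real fps"
  assumes "fps_nth g 0 \<noteq> 0"
  shows "f / g * g = f"
proof (rule dvd_div_mult_self)
  have "g dvd 1"
    using assms by simp
  then show "g dvd f"
    by (rule unit_imp_dvd)
qed

text \<open>In terms of \<open>q\<close> the factor \<open>1 + t - v T^2\<close> is \<open>T^2 (1 - v Q) / Q\<close>, where
  \<open>Q = 1 + q + q^2\<close>; all powers of \<open>T\<close> in \<open>a\<close> then cancel.\<close>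
lemma a_fun_eq:
  assumes "fps_nth v 0 = 0"
  shows "a_fun v * (1 - v * Q_fps) = q_fps ^ 3 * Q_fps * (fps_X - v)"
proof -
  define r where "r = inverse Q_fps"
  note Qr = Q_fps_inverse[folded r_def] and X = X_eq[folded r_def]
    and X1 = one_plus_X_eq[folded r_def]
  have T: "T_fps = 1 + q_fps"
    by (simp add: q_fps_def)
  have "a_fun v * ((1 + fps_X) ^ 3 * (1 + fps_X - v * T_fps ^ 2)) = (fps_X - v) * fps_X ^ 3 * T_fps ^ 8"
    unfolding a_fun_def by (rule fps_divide_mult_unit) (simp add: assms fps_nth_power_0)
  moreover have "(1 + fps_X) ^ 3 * (1 + fps_X - v * T_fps ^ 2) =
      (T_fps ^ 8 * r ^ 4) * (1 - v * Q_fps)"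
    unfolding X1 T using Qr by algebra
  moreover have "(fps_X - v) * fps_X ^ 3 * T_fps ^ 8 =
      (T_fps ^ 8 * r ^ 4) * (q_fps ^ 3 * Q_fps * (fps_X - v))"
    using Qr X by algebra
  ultimately have "a_fun v * ((T_fps ^ 8 * r ^ 4) * (1 - v * Q_fps)) =
      (T_fps ^ 8 * r ^ 4) * (q_fps ^ 3 * Q_fps * (fps_X - v))"
    by (simp only:)
  then have "(T_fps ^ 8 * r ^ 4) * (a_fun v * (1 - v * Q_fps)) =
      (T_fps ^ 8 * r ^ 4) * (q_fps ^ 3 * Q_fps * (fps_X - v))"
    by (simp only: mult_ac)
  moreover have "T_fps \<noteq> 0" "r \<noteq> 0"
    using T_fps_nth_0 Qr by auto
  ultimately show ?thesis
    by simp
qed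

lemma b_fun_eq:
  assumes "fps_nth v 0 = 0"
  shows "b_fun v * ((1 - v) * (1 - q_fps * v) * (1 - v * Q_fps)) = q_fps * (1 - q_fps ^ 2)"
proof -
  define r where "r = inverse Q_fps"
  note Qr = Q_fps_inverse[folded r_def] and X = X_eq[folded r_def]
    and X1 = one_plus_X_eq[folded r_def]
  have T: "T_fps = 1 + q_fps"
    by (simp add: q_fps_def)
  have "b_fun v * ((1 - v) * (1 + v - v * T_fps) * (1 + fps_X - v * T_fps ^ 2)) =
      fps_X * T_fps ^ 3 * (2 - T_fps)"
    unfolding b_fun_def by (rule fps_divide_mult_unit) (simp add: assms)
  moreover have "(1 - v) * (1 + v - v * T_fps) * (1 + fps_X - v * T_fps ^ 2) =
      (T_fps ^ 2 * r) * ((1 - v) * (1 - q_fps * v) * (1 - v * Q_fps))"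
    unfolding X1 T using Qr by algebra
  moreover have "fps_X * T_fps ^ 3 * (2 - T_fps) = (T_fps ^ 2 * r) * (q_fps * (1 - q_fps ^ 2))"
    unfolding X T by algebra
  ultimately have "b_fun v * ((T_fps ^ 2 * r) * ((1 - v) * (1 - q_fps * v) * (1 - v * Q_fps))) =
      (T_fps ^ 2 * r) * (q_fps * (1 - q_fps ^ 2))"
    by (simp only:)
  then have "(T_fps ^ 2 * r) * (b_fun v * ((1 - v) * (1 - q_fps * v) * (1 - v * Q_fps))) =
      (T_fps ^ 2 * r) * (q_fps * (1 - q_fps ^ 2))"
    by (simp only: mult_ac)
  moreover have "T_fps \<noteq> 0" "r \<noteq> 0"
    using T_fps_nth_0 Qr by auto
  ultimately show ?thesis
    by simp
qed

lemma fps_X_dvd_q_fps: "fps_X dvd q_fps"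
  using X_mult_Q_fps by (metis dvd_triv_left)

lemma fps_nth_0_if_X_dvd: "fps_X dvd (v :: real fps) \<Longrightarrow> fps_nth v 0 = 0"
  using fps_X_power_dvd_iff[of 1 v] by simp

lemma fps_X_dvd_a_fun:
  assumes "fps_X dvd v"
  shows "fps_X dvd a_fun v"
proof -
  have v0: "fps_nth v 0 = 0"
    using assms by (rule fps_nth_0_if_X_dvd)
  have "fps_X ^ 1 dvd (1 - v * Q_fps) * a_fun v"
    using a_fun_eq[OF v0] assms by (simp add: mult.commute dvd_diff dvd_mult)
  then show ?thesis
    by (subst (asm) fps_X_power_dvd_unit_mult_iff) (simp_all add: v0)
qed

text \<open>The q-difference equation \<open>\<Psi>(v) = b(v) + a(v) \<Psi>(q v)\<close>: after multiplication by the units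
  \<open>(1 - v) (1 - q v) (1 - v Q)\<close>, the two sides differ by a multiple of \<open>v^N\<close>.\<close>
lemma plateau_sum_step:
  assumes "fps_X dvd v"
  shows "fps_X ^ N dvd plateau_sum N v - (b_fun v + a_fun v * plateau_sum N (q_fps * v))"
proof -
  define E where "E = (1 - v) * (1 - q_fps * v)"
  define h where "h = - q_fps * (1 + q_fps) * ((1 - q_fps * v) - q_fps ^ (N + 1) * (1 - v)) -
    E * Q_fps * (1 - q_fps ^ (N + 2)) * (cont_fps N N - 1)"
  have v0: "fps_nth v 0 = 0"
    using assms by (rule fps_nth_0_if_X_dvd)
  note geo = geometric_difference[of v q_fps N, folded E_def]
  note b = b_fun_eq[OF v0, folded E_def] and a = a_fun_eq[OF v0]
  let ?D = "1 - v * Q_fps" and ?\<Psi> = "plateau_sum N v" and ?\<Psi>q = "plateau_sum N (q_fps * v)"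
    and ?S = "\<Sum>a<N. (1 - q_fps ^ (a + 1)) * v ^ a"
  have "(E * ?D) * (?\<Psi> - (b_fun v + a_fun v * ?\<Psi>q)) =
      E * (?D * ?\<Psi>) - b_fun v * (E * ?D) - E * ((a_fun v * ?D) * ?\<Psi>q)"
    by (simp add: right_diff_distrib distrib_left mult_ac)
  also have "\<dots> = q_fps * (1 + q_fps) * (E * ?S) - q_fps * (1 - q_fps ^ 2) -
      E * Q_fps * (1 - q_fps ^ (N + 2)) * (cont_fps N N - 1) * v ^ N"
    unfolding plateau_sum_functional a b by (simp add: algebra_simps)
  also have "\<dots> = v ^ N * h"
    unfolding geo h_def by algebra
  finally have "(E * ?D) * (?\<Psi> - (b_fun v + a_fun v * ?\<Psi>q)) = v ^ N * h" .
  moreover have "fps_X ^ N dvd v ^ N * h"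
    using assms by (intro dvd_mult2 dvd_power_same)
  moreover have "fps_nth (E * (1 - v * Q_fps)) 0 \<noteq> 0"
    by (simp add: E_def v0)
  ultimately show ?thesis
    by (metis fps_X_power_dvd_unit_mult_iff)
qed

lemma arg_fps_eq:
  assumes "1 \<le> j"
  shows "arg_fps j = q_fps ^ j * inverse T_fps"
proof -
  have unit: "fps_nth ((1 + fps_X :: real fps) ^ j) 0 \<noteq> 0"
    by (simp add: fps_nth_power_0)
  have T: "T_fps * inverse T_fps = 1"
    using T_fps_inverse by (simp add: q_fps_def)
  have "fps_X ^ j * T_fps ^ (2 * j - 1) * T_fps = fps_X ^ j * T_fps ^ (2 * j)"
    using assms by (simp add: mult.assoc flip: power_Suc2)
  also have "\<dots> = (fps_X * T_fps ^ 2) ^ j"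
    by (simp add: power_mult_distrib power_mult)
  also have "\<dots> = q_fps ^ j * (1 + fps_X) ^ j"
    unfolding T_fps_quadratic by (simp add: power_mult_distrib q_fps_def mult.commute)
  finally have "fps_X ^ j * T_fps ^ (2 * j - 1) * (T_fps * inverse T_fps) =
      q_fps ^ j * (1 + fps_X) ^ j * inverse T_fps"
    by (simp only: flip: mult.assoc)
  then have "fps_X ^ j * T_fps ^ (2 * j - 1) = q_fps ^ j * inverse T_fps * (1 + fps_X) ^ j"
    unfolding T by (simp only: mult_1_right mult_1_left mult_ac)
  moreover have "(1 + fps_X :: real fps) ^ j \<noteq> 0"
    using unit by (rule fps_nonzeroI)
  ultimately show ?thesis
    unfolding arg_fps_def by simp
qed

lemma fps_X_dvd_arg_fps: "1 \<le> j \<Longrightarrow> fps_X dvd arg_fps j"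
  using fps_X_dvd_q_fps by (auto simp: arg_fps_eq intro!: dvd_mult2 dvd_trans[OF _ dvd_power])

lemma fps_X_power_dvd_prod_a_fun: "fps_X ^ k dvd (\<Prod>i\<in>{1..<Suc k}. a_fun (arg_fps i))"
proof (induction k)
  case (Suc k)
  have "fps_X ^ k * fps_X dvd
      (\<Prod>i\<in>{1..<Suc k}. a_fun (arg_fps i)) * a_fun (arg_fps (Suc k))"
    by (intro mult_dvd_mono Suc.IH fps_X_dvd_a_fun fps_X_dvd_arg_fps) simp
  then show ?case
    by (simp add: mult.commute)
qed simp

text \<open>The q-difference equation applied \<open>K\<close> times.\<close>
lemma plateau_sum_expansion:
  "fps_X ^ N dvd plateau_sum N (arg_fps 1) -
    ((\<Sum>k<K. b_fun (arg_fps (Suc k)) * (\<Prod>i\<in>{1..<Suc k}. a_fun (arg_fps i))) +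
     (\<Prod>i\<in>{1..<Suc K}. a_fun (arg_fps i)) * plateau_sum N (arg_fps (Suc K)))"
proof (induction K)
  case (Suc K)
  let ?v = "arg_fps (Suc K)" and ?P = "\<Prod>i\<in>{1..<Suc K}. a_fun (arg_fps i)"
  have "arg_fps (Suc (Suc K)) = q_fps * ?v"
    by (simp add: arg_fps_eq)
  then have "fps_X ^ N dvd
      ?P * (plateau_sum N ?v - (b_fun ?v + a_fun ?v * plateau_sum N (arg_fps (Suc (Suc K)))))"
    using plateau_sum_step[of ?v N] fps_X_dvd_arg_fps[of "Suc K"] by simp
  from dvd_add[OF Suc.IH this] show ?case
    by (simp add: algebra_simps)
qed simp

text \<open>Each factor \<open>a(v)\<close> is divisible by \<open>t\<close>, so the remainder after \<open>N\<close> iterations and the tail of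
  the series are both negligible modulo \<open>t^N\<close>.\<close>
lemma plateau_sum_expansion_limit:
  defines "u \<equiv> \<lambda>k. b_fun (arg_fps (Suc k)) * (\<Prod>i\<in>{1..<Suc k}. a_fun (arg_fps i))"
  shows "summable u" and "fps_X ^ N dvd plateau_sum N (arg_fps 1) - suminf u"
proof -
  have u: "fps_X ^ k dvd u k" for k
    unfolding u_def by (intro dvd_mult fps_X_power_dvd_prod_a_fun)
  show "summable u"
    using u by (rule summable_fps_if_X_powers_dvd)
  let ?R = "(\<Prod>i\<in>{1..<Suc N}. a_fun (arg_fps i)) * plateau_sum N (arg_fps (Suc N))"
  have "fps_X ^ N dvd ?R"
    by (intro dvd_mult2 fps_X_power_dvd_prod_a_fun)
  moreover have "fps_X ^ N dvd plateau_sum N (arg_fps 1) - ((\<Sum>k<N. u k) + ?R)"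
    unfolding u_def by (rule plateau_sum_expansion)
  moreover have "fps_X ^ N dvd suminf u - (\<Sum>k<N. u k)"
    using u by (rule summable_fps_if_X_powers_dvd)
  ultimately have "fps_X ^ N dvd ?R + (plateau_sum N (arg_fps 1) - ((\<Sum>k<N. u k) + ?R)) -
      (suminf u - (\<Sum>k<N. u k))"
    using dvd_add dvd_diff by blast
  then show "fps_X ^ N dvd plateau_sum N (arg_fps 1) - suminf u"
    by simp
qed

section \<open>The generating function\<close>

lemma plateau_sum_by_parts:
  assumes "1 \<le> c"
  shows "cont_fps 1 1 + (\<Sum>l\<in>{1..<c}. y ^ l * (cont_fps (Suc l) (Suc l) - cont_fps l l)) =
    1 + (1 - y) * plateau_sum c y + y ^ c * (cont_fps c c - 1)"
  using assms
proof (induction c rule: nat_induct_at_least)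
  case base
  show ?case
    by (simp add: plateau_sum_def algebra_simps)
next
  case (Suc c)
  then show ?case
    by (simp add: plateau_sum_def algebra_simps)
qed

text \<open>The weights are now the powers of \<open>y = q / T\<close>. As \<open>y\<close> is divisible by \<open>t\<close>, the boundary term
  with \<open>g c c\<close> disappears modulo \<open>t^c\<close>, and summation by parts turns the sum over the
  differences \<open>f (l + 1) - f l\<close> into \<open>\<Psi>(y)\<close>. The other root \<open>1 / T\<close> has constant term 1 and would
  leave a boundary term of order 0.\<close>
lemma cont_fps_1_plateau_sum:
  "fps_X ^ c dvd fps_X * cont_fps 1 c -
    (q_fps * (1 + fps_X) + q_fps * fps_X * inverse T_fps * plateau_sum c (arg_fps 1))"
proof (cases "1 \<le> c")
  case True
  define U where "U = inverse T_fps"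
  define r where "r = inverse Q_fps"
  define y where "y = q_fps * U"
  note TU = T_fps_inverse[folded U_def] and Qr = Q_fps_inverse[folded r_def]
    and X = X_eq[folded r_def] and X1 = one_plus_X_eq[folded r_def]
  have arg: "arg_fps 1 = y"
    by (simp add: arg_fps_eq y_def U_def)
  have y2: "(1 + fps_X) * y ^ 2 = (1 + fps_X) * y - fps_X"
    unfolding y_def using X X1 TU by algebra
  have rec: "(1 + fps_X) * y ^ Suc (Suc m) = (1 + fps_X) * y ^ Suc m - fps_X * y ^ m" for m
    using arg_cong[OF y2, of "\<lambda>z. y ^ m * z"] by (simp add: power2_eq_square algebra_simps)
  have "1 - (1 + fps_X) * y = r"
    unfolding y_def using X1 TU Qr by algebra
  then have lhs: "y ^ 0 - (1 + fps_X) * y ^ 1 = r"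
    by simp
  have y1: "1 - y = U"
    unfolding y_def using TU by algebra
  let ?S = "\<Sum>l\<in>{1..<c}. y ^ l * (cont_fps (Suc l) (Suc l) - cont_fps l l)"
  have "r * cont_fps 1 c + (1 + fps_X) * y ^ c * cont_fps c c =
      1 + fps_X * (cont_fps 1 1 + ?S)"
    using weighted_cont_fps[of "\<lambda>m. y ^ m" c, OF rec True] unfolding lhs
    by (simp add: distrib_left)
  also have "\<dots> = 1 + fps_X * (1 + U * plateau_sum c y + y ^ c * (cont_fps c c - 1))"
    unfolding plateau_sum_by_parts[OF True] y1 ..
  finally have rG: "r * cont_fps 1 c =
      1 + fps_X * (1 + U * plateau_sum c y + y ^ c * (cont_fps c c - 1)) -
      (1 + fps_X) * y ^ c * cont_fps c c"
    by (simp only: eq_diff_eq)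
  have "fps_X * cont_fps 1 c = q_fps * (r * cont_fps 1 c)"
    using X by (metis mult.assoc)
  then have "fps_X * cont_fps 1 c - (q_fps * (1 + fps_X) + q_fps * fps_X * U * plateau_sum c y) =
      y ^ c * (- q_fps * (fps_X + cont_fps c c))"
    unfolding rG by (simp add: algebra_simps)
  moreover have "fps_X ^ c dvd y ^ c"
    unfolding arg[symmetric] by (intro dvd_power_same fps_X_dvd_arg_fps) simp
  ultimately show ?thesis
    unfolding arg U_def[symmetric] by simp
qed simp

lemma avoid_count_fps_cong:
  "fps_X ^ c dvd
    Abs_fps (\<lambda>n. if n \<ge> 1 then real (avoid_count contains_11_2 n) else 0) - fps_X * cont_fps 1 c"
  unfolding fps_X_power_dvd_iff
proof (intro allI impI)
  fix n
  assume "n < c"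
  then show "fps_nth (Abs_fps (\<lambda>n. if n \<ge> 1 then real (avoid_count contains_11_2 n) else 0) -
      fps_X * cont_fps 1 c) n = 0"
    using avoid_count_eq_card_capped_cont[of "n - 1" c]
    by (cases n) (simp_all add: cont_fps_def)
qed

theorem theorem3p5:
  shows "summable (\<lambda>k. b_fun (arg_fps (Suc k)) * (\<Prod>i\<in>{1..<Suc k}. a_fun (arg_fps i))) \<and>
    Abs_fps (\<lambda>n. if n \<ge> 1 then real (avoid_count contains_11_2 n) else 0) =
      (1 + fps_X) * (1 - fps_X - sqrt_disc) / (2 * fps_X) +
      fps_X ^ 2 * T_fps / (1 + fps_X) *
        (\<Sum>k. b_fun (arg_fps (Suc k)) * (\<Prod>i\<in>{1..<Suc k}. a_fun (arg_fps i)))"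
proof -
  define u where "u = (\<lambda>k. b_fun (arg_fps (Suc k)) * (\<Prod>i\<in>{1..<Suc k}. a_fun (arg_fps i)))"
  define A where "A = Abs_fps (\<lambda>n. if n \<ge> 1 then real (avoid_count contains_11_2 n) else 0)"
  define C where "C = q_fps * fps_X * inverse T_fps"
  note u = plateau_sum_expansion_limit[folded u_def]
  have "A = q_fps * (1 + fps_X) + C * suminf u"
  proof (rule fps_eq_if_X_powers_dvd_diff)
    fix N
    have "fps_X ^ N dvd (A - fps_X * cont_fps 1 N) +
        (fps_X * cont_fps 1 N - (q_fps * (1 + fps_X) + C * plateau_sum N (arg_fps 1))) +
        C * (plateau_sum N (arg_fps 1) - suminf u)"
      unfolding A_def C_def
      by (intro dvd_add avoid_count_fps_cong cont_fps_1_plateau_sum dvd_mult u(2))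
    then show "fps_X ^ N dvd A - (q_fps * (1 + fps_X) + C * suminf u)"
      by (simp add: algebra_simps)
  qed
  moreover have "(1 + fps_X) * (1 - fps_X - sqrt_disc) / (2 * fps_X) = q_fps * (1 + fps_X)"
  proof -
    have "(1 + fps_X) * (1 - fps_X - sqrt_disc) = q_fps * (1 + fps_X) * (2 * fps_X)"
      using T_fps_mult unfolding q_fps_def by algebra
    then show ?thesis
      by (simp only:) (rule nonzero_mult_div_cancel_right, simp)
  qed
  moreover have "fps_X ^ 2 * T_fps / (1 + fps_X) = C"
  proof -
    have "fps_X ^ 2 * T_fps = C * (1 + fps_X)"
    proof -
      have "(1 + q_fps) * (fps_X ^ 2 * T_fps) = fps_X * q_fps * (1 + fps_X)"
        using T_fps_quadratic unfolding q_fps_def by algebra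
      then show ?thesis
        unfolding C_def using T_fps_inverse by algebra
    qed
    moreover have "(1 + fps_X :: real fps) \<noteq> 0"
      by (rule fps_nonzeroI[of _ 0]) simp
    ultimately show ?thesis
      by simp
  qed
  ultimately show ?thesis
    using u(1) unfolding u_def A_def by simp
qed

end
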